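(* Let $D\subseteq\mathbb{C}$ be a nonempty open or closed set such that $\mathbb{C}\setminus D$ is convex. If a matrix polynomial $P(\lambda)\in\mathbb{C}^{n,n}[\lambda]$ is hyperstable with respect to $D$ and the ($n^2$) entries of its derivative $P'(\lambda)$ are linearly independent polynomials (over $\mathbb{C}$), then the matrix polynomial $P'(\lambda)$ is also hyperstable with respect to $D$.
   Context: $\mathbb{C}^{n,n}[\lambda]$ denotes the polynomials in $\lambda$ with coefficients in $\mathbb{C}^{n,n}$ ($n\times n$ complex matrices); the derivative is taken entrywise. For a nonempty open or closed $D\subseteq\mathbb{C}$, $P$ is hyperstable with respect to $D$ if for every $x\in\mathbb{C}^n\setminus\{0\}$ there exists $y\in\mathbb{C}^n\setminus\{0\}$ such that $y^*P(\mu)x\neq0$ for all $\mu\in D$. *)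

theory Defs
  imports "HOL-Analysis.Analysis" "HOL-Computational_Algebra.Polynomial"
begin

(* A matrix polynomial is represented by the matrix of its entries, using
   C^{n,n}[lambda] = (C[lambda])^{n,n}. *)
type_synonym 'n matpoly = "complex poly ^ 'n ^ 'n"

definition eval_matpoly :: "'n::finite matpoly \<Rightarrow> complex \<Rightarrow> complex ^ 'n ^ 'n" where
  "eval_matpoly P z = map_matrix (\<lambda>p. poly p z) P"

definition deriv_matpoly :: "'n::finite matpoly \<Rightarrow> 'n matpoly" where
  "deriv_matpoly P = map_matrix pderiv P"

(* The complex number y^* v. The library's inner product on complex ^ 'n is only its real part. *)
definition ctimes_vec :: "complex ^ 'n::finite \<Rightarrow> complex ^ 'n \<Rightarrow> complex" where
  "ctimes_vec y v = (\<Sum>i\<in>UNIV. cnj (y $ i) * v $ i)"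

definition hyperstable :: "'n::finite matpoly \<Rightarrow> complex set \<Rightarrow> bool" where
  "hyperstable P D \<longleftrightarrow>
     (\<forall>x. x \<noteq> 0 \<longrightarrow>
        (\<exists>y. y \<noteq> 0 \<and> (\<forall>z\<in>D. ctimes_vec y (eval_matpoly P z *v x) \<noteq> 0)))"

(* Linear independence of the entries as a family indexed by pairs (i, j): module.dependent only
   sees the set of entries, so injectivity excludes repeated entries. *)
definition entries_lin_indep :: "'n::finite matpoly \<Rightarrow> bool" where
  "entries_lin_indep A \<longleftrightarrow>
     inj (\<lambda>(i, j). A $ i $ j) \<and> \<not> module.dependent smult (range (\<lambda>(i, j). A $ i $ j))"

lemma vector_space_smult: "vector_space (smult :: complex \<Rightarrow> complex poly \<Rightarrow> complex poly)"
  by unfold_locales (simp_all add: smult_add_right smult_add_left)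

lemma entries_lin_indep_iff:
  fixes A :: "'n::finite matpoly"
  shows "entries_lin_indep A \<longleftrightarrow>
    (\<forall>c :: 'n \<Rightarrow> 'n \<Rightarrow> complex.
       (\<Sum>i\<in>UNIV. \<Sum>j\<in>UNIV. smult (c i j) (A $ i $ j)) = 0 \<longrightarrow> (\<forall>i j. c i j = 0))"
    (is "_ \<longleftrightarrow> ?R")
proof -
  interpret V: vector_space "smult :: complex \<Rightarrow> complex poly \<Rightarrow> complex poly"
    by (rule vector_space_smult)
  define f where "f = (\<lambda>(i, j). A $ i $ j)"
  have dep: "V.dependent (range f) \<longleftrightarrow> (\<exists>u. (\<exists>v\<in>range f. u v \<noteq> 0) \<and> (\<Sum>v\<in>range f. smult (u v) v) = 0)"
    by (rule V.dependent_finite) simp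
  have dbl: "(\<Sum>i\<in>UNIV. \<Sum>j\<in>UNIV. smult (c i j) (A $ i $ j)) = (\<Sum>p\<in>UNIV. smult (case_prod c p) (f p))"
    for c :: "'n \<Rightarrow> 'n \<Rightarrow> complex"
    by (simp add: f_def sum.cartesian_product case_prod_unfold)
  have R: "?R \<longleftrightarrow> (\<forall>c. (\<Sum>p\<in>UNIV. smult (c p) (f p)) = 0 \<longrightarrow> (\<forall>p. c p = 0))" (is "_ \<longleftrightarrow> ?S")
  proof
    assume r: ?R
    show ?S
    proof (intro allI impI)
      fix c :: "'n \<times> 'n \<Rightarrow> complex" and p
      assume "(\<Sum>p\<in>UNIV. smult (c p) (f p)) = 0"
      then have "(\<Sum>i\<in>UNIV. \<Sum>j\<in>UNIV. smult (curry c i j) (A $ i $ j)) = 0"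
        by (subst dbl) simp
      with r have "\<forall>i j. curry c i j = 0" by blast
      then show "c p = 0" by (cases p) simp
    qed
  next
    assume s: ?S
    show ?R
    proof (intro allI impI)
      fix c :: "'n \<Rightarrow> 'n \<Rightarrow> complex" and i j
      assume "(\<Sum>i\<in>UNIV. \<Sum>j\<in>UNIV. smult (c i j) (A $ i $ j)) = 0"
      then have "\<forall>p. case_prod c p = 0" using s unfolding dbl by blast
      then show "c i j = 0" by (metis case_prod_conv)
    qed
  qed
  have "inj f \<and> \<not> V.dependent (range f) \<longleftrightarrow> ?S"
  proof
    assume a: "inj f \<and> \<not> V.dependent (range f)"
    show ?S
    proof (intro allI impI)
      fix c :: "'n \<times> 'n \<Rightarrow> complex" and p
      assume "(\<Sum>p\<in>UNIV. smult (c p) (f p)) = 0"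
      then have "(\<Sum>v\<in>range f. smult (c (inv f v)) v) = 0"
        using a by (simp add: sum.reindex inv_f_f)
      moreover have indep: "\<not> V.dependent (range f)" using a ..
      ultimately have "c (inv f (f p)) = 0"
        by (intro V.independentD[where t = "range f" and u = "\<lambda>v. c (inv f v)", OF indep]) simp_all
      then show "c p = 0" using a by (simp add: inv_f_f)
    qed
  next
    assume s: ?S
    have inj: "inj f"
    proof (rule injI, rule ccontr)
      fix p q assume pq: "f p = f q" "p \<noteq> q"
      define c :: "'n \<times> 'n \<Rightarrow> complex" where "c = (\<lambda>r. if r = p then 1 else if r = q then - 1 else 0)"
      have "(\<Sum>r\<in>UNIV. smult (c r) (f r)) = (\<Sum>r\<in>{p, q}. smult (c r) (f r))"
        by (rule sum.mono_neutral_right) (auto simp: c_def)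
      also have "\<dots> = 0" using pq by (simp add: c_def)
      finally have "c p = 0" using s by blast
      then show False by (simp add: c_def)
    qed
    moreover have "\<not> V.dependent (range f)"
    proof
      assume "V.dependent (range f)"
      then obtain u p where u: "u (f p) \<noteq> 0" "(\<Sum>v\<in>range f. smult (u v) v) = 0"
        unfolding dep by blast
      then have "(\<Sum>p\<in>UNIV. smult ((u \<circ> f) p) (f p)) = 0"
        using inj by (simp add: sum.reindex)
      with s have "(u \<circ> f) p = 0" by blast
      with u show False by simp
    qed
    ultimately show "inj f \<and> \<not> V.dependent (range f)" ..
  qed
  then show ?thesis
    unfolding R entries_lin_indep_def f_def .
qed

end

(* For fixed x and y the scalar polynomial y^* P x has derivative y^* P' x. If y^* P x has all its
   roots in the convex set - D, then by the Gauss-Lucas theorem so does its derivative, unless the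
   latter vanishes identically; but y^* P' x = 0 would be a nontrivial linear relation between the
   entries of P', with coefficients cnj (y_i) x_j. So the y that works for P and x also works for P'. *)
theory Submission
  imports Defs "HOL-Computational_Algebra.Fundamental_Theorem_Algebra"
begin

text \<open>If \<open>z\<close> is not itself a root of \<open>p\<close>, the logarithmic derivative
  p'/p vanishes at \<open>z\<close>. Conjugating that equation displays \<open>z\<close> as a
  weighted mean of the roots with positive weights.\<close>

theorem Gauss_Lucas:
  fixes p :: "complex poly"
  assumes nz: "pderiv p \<noteq> 0" and root: "poly (pderiv p) z = 0"
  shows "z \<in> convex hull {w. poly p w = 0}"
proof (cases "poly p z = 0")
  case True
  then show ?thesis by (simp add: hull_inc)
next
  case False
  have "degree p \<noteq> 0" using nz by (simp add: pderiv_eq_0_iff)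
  \<comment> \<open>The \<open>r i\<close> list the roots with multiplicity, so the index set
    \<open>I\<close> has exactly \<open>degree p\<close> elements and is nonempty.\<close>
  obtain r where r: "smult (lead_coeff p) (\<Prod>i<degree p. [:- r i, 1:]) = p"
    by (rule complex_poly_decompose')
  define I where "I = {..<degree p}"
  have poly_p: "poly p w = lead_coeff p * (\<Prod>i\<in>I. w - r i)" for w
    by (subst r [symmetric]) (simp add: poly_prod I_def)
  have I: "finite I" "I \<noteq> {}" using \<open>degree p \<noteq> 0\<close> by (auto simp: I_def)
  have ne: "z - r i \<noteq> 0" if "i \<in> I" for i
    using False that I by (auto simp: poly_p)
  have "pderiv p = smult (lead_coeff p) (\<Sum>i\<in>I. \<Prod>j\<in>I - {i}. [:- r j, 1:])"
    by (subst r [symmetric]) (simp add: pderiv_smult pderiv_prod pderiv_pCons I_def)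
  then have "poly (pderiv p) z = lead_coeff p * (\<Sum>i\<in>I. \<Prod>j\<in>I - {i}. z - r j)"
    by (simp add: poly_sum poly_prod)
  also have "(\<Sum>i\<in>I. \<Prod>j\<in>I - {i}. z - r j) = (\<Sum>i\<in>I. (\<Prod>j\<in>I. z - r j) * (1 / (z - r i)))"
    using I ne by (intro sum.cong) (auto simp: prod_diff1)
  finally have "poly p z * (\<Sum>i\<in>I. 1 / (z - r i)) = 0"
    using root by (simp add: poly_p sum_distrib_left)
  then have log_deriv: "(\<Sum>i\<in>I. 1 / (z - r i)) = 0" using False by simp
  \<comment> \<open>The weights come from cnj (1/w) = w / |w|^2 with w = \<open>z - r i\<close>;
    dividing by their total \<open>W\<close> makes them sum to 1.\<close>
  define u where "u i = 1 / (cmod (z - r i))\<^sup>2" for i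
  define W where "W = (\<Sum>i\<in>I. u i)"
  have u_pos: "u i > 0" if "i \<in> I" for i using ne[OF that] by (simp add: u_def)
  have W: "W > 0" unfolding W_def using I u_pos by (intro sum_pos) auto
  have "cnj (1 / (z - r i)) = u i *\<^sub>R (z - r i)" for i
    by (subst complex_div_cnj) (simp add: u_def scaleR_conv_of_real)
  then have "(\<Sum>i\<in>I. u i *\<^sub>R (z - r i)) = cnj (\<Sum>i\<in>I. 1 / (z - r i))"
    by (simp only: cnj_sum)
  then have "W *\<^sub>R z = (\<Sum>i\<in>I. u i *\<^sub>R r i)"
    by (simp only: log_deriv) (simp add: W_def scaleR_diff_right sum_subtractf scaleR_left.sum)
  then have "z = (1 / W) *\<^sub>R (\<Sum>i\<in>I. u i *\<^sub>R r i)"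
    using W by (metis divide_self_if less_numeral_extra(3) scaleR_one scaleR_scaleR times_divide_eq_left mult_1)
  also have "\<dots> = (\<Sum>i\<in>I. (u i / W) *\<^sub>R r i)"
    by (simp add: scaleR_sum_right)
  also have "\<dots> \<in> convex hull {w. poly p w = 0}"
  proof (rule convex_sum)
    show "(\<Sum>i\<in>I. u i / W) = 1"
      using W by (simp add: W_def flip: sum_divide_distrib)
    show "u i / W \<ge> 0" if "i \<in> I" for i
      using u_pos[OF that] W by simp
    show "r i \<in> convex hull {w. poly p w = 0}" if "i \<in> I" for i
      using that I by (intro hull_inc) (auto simp: poly_p)
  qed (use I in auto)
  finally show ?thesis .
qed

text \<open>This is y^* P x as a formal polynomial, so that \<open>pderiv\<close> and
  \<open>Gauss_Lucas\<close> apply to it.\<close>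

definition sesq_poly :: "complex ^ 'n::finite \<Rightarrow> 'n matpoly \<Rightarrow> complex ^ 'n \<Rightarrow> complex poly" where
  "sesq_poly y P x = (\<Sum>i\<in>UNIV. \<Sum>j\<in>UNIV. smult (cnj (y $ i) * x $ j) (P $ i $ j))"

lemma poly_sesq_poly: "poly (sesq_poly y P x) z = ctimes_vec y (eval_matpoly P z *v x)"
  by (simp add: sesq_poly_def ctimes_vec_def eval_matpoly_def matrix_vector_mult_def map_matrix_def
      poly_sum sum_distrib_left mult_ac)

lemma pderiv_sesq_poly: "pderiv (sesq_poly y P x) = sesq_poly y (deriv_matpoly P) x"
  \<comment> \<open>The first-order case of \<open>higher_pderiv_sum\<close> serves as the sum rule
    for \<open>pderiv\<close>.\<close>
  by (simp add: sesq_poly_def deriv_matpoly_def map_matrix_def pderiv_smult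
      higher_pderiv_sum[of 1, simplified])

lemma sesq_poly_eq_0_iff:
  assumes "entries_lin_indep P"
  shows "sesq_poly y P x = 0 \<longleftrightarrow> y = 0 \<or> x = 0"
proof
  assume "sesq_poly y P x = 0"
  moreover have "(\<Sum>i\<in>UNIV. \<Sum>j\<in>UNIV. smult (c i j) (P $ i $ j)) = 0 \<Longrightarrow> c i j = 0" for c i j
    using assms by (simp add: entries_lin_indep_iff)
  \<comment> \<open>The relation has the rank-one coefficient matrix formed from \<open>y\<close>
    and \<open>x\<close>, which vanishes only if one of the two vectors does.\<close>
  from this[of "\<lambda>i j. cnj (y $ i) * x $ j"]
  have "sesq_poly y P x = 0 \<Longrightarrow> cnj (y $ i) * x $ j = 0" for i j
    unfolding sesq_poly_def .
  ultimately have "\<forall>i j. cnj (y $ i) * x $ j = 0" by blast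
  then show "y = 0 \<or> x = 0" by (auto simp: vec_eq_iff)
qed (auto simp: sesq_poly_def)

theorem theorem4p2:
  fixes D :: "complex set" and P :: "'n::finite matpoly"
  assumes "D \<noteq> {}"
    and "open D \<or> closed D"
    and "convex (- D)"
    and "hyperstable P D"
    and "entries_lin_indep (deriv_matpoly P)"
  shows "hyperstable (deriv_matpoly P) D"
  unfolding hyperstable_def
proof (intro allI impI)
  fix x :: "complex ^ 'n" assume "x \<noteq> 0"
  then obtain y where "y \<noteq> 0" and y: "\<forall>z\<in>D. poly (sesq_poly y P x) z \<noteq> 0"
    using \<open>hyperstable P D\<close> unfolding hyperstable_def poly_sesq_poly by blast
  have nz: "pderiv (sesq_poly y P x) \<noteq> 0"
    using \<open>x \<noteq> 0\<close> \<open>y \<noteq> 0\<close> assms(5) by (simp add: pderiv_sesq_poly sesq_poly_eq_0_iff)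
  \<comment> \<open>All roots lie in \<open>- D\<close>, so convexity of \<open>- D\<close> keeps
    their hull away from \<open>D\<close>.\<close>
  have "convex hull {w. poly (sesq_poly y P x) w = 0} \<subseteq> - D"
    using y \<open>convex (- D)\<close> by (intro hull_minimal) auto
  then have "\<forall>z\<in>D. poly (pderiv (sesq_poly y P x)) z \<noteq> 0"
    using Gauss_Lucas[OF nz] by blast
  then show "\<exists>y. y \<noteq> 0 \<and> (\<forall>z\<in>D. ctimes_vec y (eval_matpoly (deriv_matpoly P) z *v x) \<noteq> 0)"
    using \<open>y \<noteq> 0\<close> by (auto simp: pderiv_sesq_poly poly_sesq_poly)
qed

end
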